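(* Consider a LASSO (respectively CLASSO) problem and the corresponding LCA system $\dot{\mathbf{u}}=\mathbf{F}(\mathbf{u})$. Suppose the problem has a unique optimal solution $\mathbf{a}^*\in\mathcal{C}$. Then given any $\mathbf{u}^{(0)}\in\mathbb{R}^N$, the flow $\mathbf{u}(t)=\mathbf{U}(t,\mathbf{u}^{(0)})$ converges to a fixed point $\mathbf{u}^*\in\mathcal{F}$, i.e. $\mathbf{u}(t)\to\mathbf{u}^*$ as $t\to\infty$. Furthermore, $\mathbf{T}(\mathbf{u}^* )=\mathbf{a}^*$.
   Context: Data: $\mathbf{s}\in\mathbb{R}^M$, a real number $\lambda>0$, and a matrix $\Phi=[\boldsymbol\phi_1,\ldots,\boldsymbol\phi_N]\in\mathbb{R}^{M\times N}$ whose columns have unit Euclidean norm. Put $E(\mathbf{a})=\frac12\|\mathbf{s}-\Phi\mathbf{a}\|_2^2+\lambda\|\mathbf{a}\|_1$ for $\mathbf{a}\in\mathbb{R}^N$. LASSO is the problem of minimizing $E$ over $\mathbb{R}^N$; CLASSO is the problem of minimizing $E$ over $\{\mathbf{a}\in\mathbb{R}^N\mid a_n\ge 0 \text{ for all } n\}$. $\mathcal{C}$ denotes the set of optimal solutions of the problem considered. Activation function: let $T_\lambda(x)=x-\lambda$ for $x>\lambda$ and $T_\lambda(x)=0$ for $x\le\lambda$; let $T_{\pm\lambda}(x)=T_\lambda(x)-T_\lambda(-x)$. Set $T=T_{\pm\lambda}$ for LASSO and $T=T_\lambda$ for CLASSO, and let $\mathbf{T}:\mathbb{R}^N\to\mathbb{R}^N$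 apply $T$ to each component. LCA is the dynamical system $\dot{\mathbf{u}}=\mathbf{F}(\mathbf{u})$, $\mathbf{F}(\mathbf{u})=\mathbf{b}-\mathbf{u}-(\Phi^T\Phi-I)\mathbf{T}(\mathbf{u})$, $\mathbf{b}=\Phi^T\mathbf{s}$. Its solution for $t\ge0$ with initial position $\mathbf{u}^{(0)}$ is the flow $\mathbf{U}(t,\mathbf{u}^{(0)})$. $\mathcal{F}=\{\mathbf{u}\in\mathbb{R}^N\mid\mathbf{F}(\mathbf{u})=\mathbf{0}\}$ is the set of fixed points of LCA. *)

theory Defs
  imports "HOL-Analysis.Analysis"
begin

datatype problem = LASSO | CLASSO

definition l1_norm :: "real ^ 'n \<Rightarrow> real" where
  "l1_norm a = (\<Sum>i\<in>UNIV. \<bar>a $ i\<bar>)"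

definition energy :: "real ^ 'n ^ 'm \<Rightarrow> real ^ 'm \<Rightarrow> real \<Rightarrow> real ^ 'n \<Rightarrow> real" where
  "energy \<Phi> s lam a = 1 / 2 * (norm (s - \<Phi> *v a))\<^sup>2 + lam * l1_norm a"

fun feasible :: "problem \<Rightarrow> (real ^ 'n) set" where
  "feasible LASSO = UNIV"
| "feasible CLASSO = {a. \<forall>i. a $ i \<ge> 0}"

definition optimal_solutions ::
    "problem \<Rightarrow> real ^ 'n ^ 'm \<Rightarrow> real ^ 'm \<Rightarrow> real \<Rightarrow> (real ^ 'n) set" where
  "optimal_solutions P \<Phi> s lam = {a. is_arg_min (energy \<Phi> s lam) (\<lambda>a. a \<in> feasible P) a}"

definition threshold :: "real \<Rightarrow> real \<Rightarrow> real" where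
  "threshold lam x = (if x > lam then x - lam else 0)"

fun activation :: "problem \<Rightarrow> real \<Rightarrow> real \<Rightarrow> real" where
  "activation LASSO lam x = threshold lam x - threshold lam (- x)"
| "activation CLASSO lam x = threshold lam x"

definition activation_vec :: "problem \<Rightarrow> real \<Rightarrow> real ^ 'n \<Rightarrow> real ^ 'n" where
  "activation_vec P lam u = (\<chi> i. activation P lam (u $ i))"

definition lca_field ::
    "problem \<Rightarrow> real ^ 'n ^ 'm \<Rightarrow> real ^ 'm \<Rightarrow> real \<Rightarrow> real ^ 'n \<Rightarrow> real ^ 'n" where
  "lca_field P \<Phi> s lam u =
     transpose \<Phi> *v s - u - (transpose \<Phi> ** \<Phi> - mat 1) *v activation_vec P lam u"

definition lca_fixed_points ::
    "problem \<Rightarrow> real ^ 'n ^ 'm \<Rightarrow> real ^ 'm \<Rightarrow> real \<Rightarrow> (real ^ 'n) set" where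
  "lca_fixed_points P \<Phi> s lam = {u. lca_field P \<Phi> s lam u = 0}"

definition lca_solution ::
    "problem \<Rightarrow> real ^ 'n ^ 'm \<Rightarrow> real ^ 'm \<Rightarrow> real \<Rightarrow> real ^ 'n \<Rightarrow> (real \<Rightarrow> real ^ 'n) \<Rightarrow> bool" where
  "lca_solution P \<Phi> s lam u0 u \<longleftrightarrow> u 0 = u0 \<and>
     (\<forall>t\<ge>0. (u has_vector_derivative lca_field P \<Phi> s lam (u t)) (at t within {0..}))"

(* The field is globally Lipschitz, so for t \<ge> 0 exactly one point x qualifies. The description
   is pointwise in t because a solution, as a total function, is arbitrary at negative times;
   the flow is meaningful only for t \<ge> 0. *)
definition lca_flow ::
    "problem \<Rightarrow> real ^ 'n ^ 'm \<Rightarrow> real ^ 'm \<Rightarrow> real \<Rightarrow> real \<Rightarrow> real ^ 'n \<Rightarrow> real ^ 'n" where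
  "lca_flow P \<Phi> s lam t u0 = (THE x. \<exists>u. lca_solution P \<Phi> s lam u0 u \<and> u t = x)"

end

theory Submission
  imports Defs
begin

text \<open>
The state \<open>u\<close> is split into its activation \<open>a = T u\<close> and the residual \<open>u - a\<close>.  The residual is a
subgradient of the penalty \<open>lam * l1_norm\<close> at \<open>a\<close> (relative to the feasible set), so that
\<open>F u = \<Phi>\<^sup>T (s - \<Phi> a) - (u - a)\<close> is the negative of a subgradient of the energy \<open>E\<close> at \<open>a\<close>.

The energy of the activation is not differentiable along the flow.  A differentiable Lyapunov
function comes from the other side: \<open>T\<close> is the gradient of the convex function
\<open>\<psi> u = (norm (T u))\<^sup>2 / 2\<close>.  With the optimum \<open>a\<^sup>*\<close>, the function \<open>D u = \<psi> u - a\<^sup>* \<bullet> u\<close>, normalized by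
a constant (\<open>bregman_gap\<close>), therefore satisfies along the flow
\<open>D' = (a - a\<^sup>*) \<bullet> F u \<le> E a\<^sup>* - E a \<le> 0\<close> by the subgradient inequality for \<open>E\<close>
(\<open>inner_lca_field_le_energy_gap\<close>), and it dominates half the squared distance of \<open>a\<close> from \<open>a\<^sup>*\<close>.

So the activation stays in a ball, and then the state, which relaxes at unit rate towards a function
of the activation, is bounded and moves with bounded speed.  As the optimum is unique, \<open>E a - E a\<^sup>*\<close>
is bounded below by a positive constant wherever \<open>a\<close> is at least \<open>e\<close> away from \<open>a\<^sup>*\<close> within that
ball; a trajectory whose activation kept returning there would drive \<open>D\<close> below zero
(\<open>tendsto_of_lyapunov_decrease\<close>).  Hence \<open>a\<close> converges to \<open>a\<^sup>*\<close>.

Finally \<open>u' = g - u\<close>, where \<open>g\<close>, a continuous function of \<open>a\<close>, converges to some \<open>u\<^sup>*\<close>; so \<open>u\<close>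
converges to \<open>u\<^sup>*\<close> as well (\<open>forced_decay_tendsto_0\<close>).  Continuity of \<open>T\<close> gives \<open>T u\<^sup>* = a\<^sup>*\<close>, and
with it \<open>F u\<^sup>* = 0\<close>: the existence of a fixed point is a result of the argument, not an input.  That
there is exactly one flow to speak of is the global Cauchy-Lipschitz theorem on the half-line.
\<close>

section \<open>Differential equations on the half-line\<close>

lemma half_line_vector_derivative_at:
  assumes "(f has_vector_derivative D) (at t within {0..})" "(0::real) < t"
  shows "(f has_vector_derivative D) (at t)"
proof -
  have "at t within {0..} = at t"
    by (rule at_within_open_subset[of _ "{0<..}"]) (use assms(2) in auto)
  then show ?thesis
    using assms(1) by simp
qed

lemma half_line_continuous_on:
  assumes "\<And>t. 0 \<le> t \<Longrightarrow> (f has_vector_derivative f' t) (at t within {0::real..})"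
  shows "continuous_on {0..} f"
  unfolding continuous_on_eq_continuous_within
proof
  fix t :: real assume "t \<in> {0..}"
  then have "(f has_vector_derivative f' t) (at t within {0..})"
    by (intro assms) simp
  then show "continuous (at t within {0..}) f"
    by (rule has_vector_derivative_continuous)
qed

lemma norm_increment_le_increment:
  fixes y :: "real \<Rightarrow> 'a::real_normed_vector"
  assumes y: "\<And>t. 0 \<le> t \<Longrightarrow> (y has_vector_derivative y' t) (at t within {0..})"
    and \<phi>: "\<And>r. (\<phi> has_real_derivative \<phi>' r) (at r)"
    and bound: "\<And>r. p \<le> r \<Longrightarrow> r \<le> q \<Longrightarrow> norm (y' r) \<le> \<phi>' r"
    and "0 \<le> p" "p \<le> q"
  shows "norm (y q - y p) \<le> \<phi> q - \<phi> p"
proof (cases "p = q")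
  case True
  then show ?thesis by simp
next
  case False
  show ?thesis
  proof (rule differentiable_bound_general)
    show "p < q"
      using False \<open>p \<le> q\<close> by simp
    show "continuous_on {p..q} y"
      by (rule continuous_on_subset[OF half_line_continuous_on[OF y]]) (use \<open>0 \<le> p\<close> in auto)
    show "continuous_on {p..q} \<phi>"
      using \<phi> by (rule DERIV_continuous_on[OF DERIV_subset]) simp
    show "(y has_vector_derivative y' r) (at r)" if "p < r" "r < q" for r
      by (rule half_line_vector_derivative_at[OF y]) (use that \<open>0 \<le> p\<close> in simp_all)
    show "(\<phi> has_vector_derivative \<phi>' r) (at r)" for r
      using \<phi> by (simp only: has_real_derivative_iff_has_vector_derivative)
    show "norm (y' r) \<le> \<phi>' r" if "p < r" "r < q" for r
      by (rule bound) (use that in simp_all)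
  qed
qed

text \<open>The exponential weight serves twice: in the weighted norm that makes Picard iteration contract,
and in the relaxation estimate for equations of the form \<open>w' = h - w\<close>.\<close>

lemma norm_increment_le_exp_increment:
  fixes y :: "real \<Rightarrow> 'a::real_normed_vector"
  assumes y: "\<And>t. 0 \<le> t \<Longrightarrow> (y has_vector_derivative y' t) (at t within {0..})"
    and bound: "\<And>r. p \<le> r \<Longrightarrow> r \<le> q \<Longrightarrow> norm (y' r) \<le> B * exp (c * r)"
    and "0 \<le> p" "p \<le> q" "c > 0"
  shows "norm (y q - y p) \<le> B / c * (exp (c * q) - exp (c * p))"
proof -
  have "((\<lambda>r. B / c * exp (c * r)) has_real_derivative B * exp (c * r)) (at r)" for r
  proof -
    have "((\<lambda>r. B / c * exp (c * r)) has_real_derivative B / c * (exp (c * r) * c)) (at r)"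
      by (rule derivative_eq_intros refl)+ simp
    then show ?thesis
      using \<open>c > 0\<close> by simp
  qed
  from norm_increment_le_increment[OF y this bound \<open>0 \<le> p\<close> \<open>p \<le> q\<close>]
  show ?thesis
    by (simp only: right_diff_distrib)
qed

lemma real_increment_le:
  fixes f :: "real \<Rightarrow> real"
  assumes f: "\<And>t. 0 \<le> t \<Longrightarrow> (f has_real_derivative f' t) (at t within {0..})"
    and bound: "\<And>r. p \<le> r \<Longrightarrow> r \<le> q \<Longrightarrow> f' r \<le> C"
    and "0 \<le> p" "p \<le> q"
  shows "f q - f p \<le> C * (q - p)"
proof -
  have "\<exists>r\<in>{p..q}. f q - f p = f' r * (q - p)"
  proof (rule mvt_very_simple)
    show "(f has_derivative (*) (f' r)) (at r within {p..q})" if "p \<le> r" "r \<le> q" for r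
    proof -
      have "(f has_real_derivative f' r) (at r within {p..q})"
        by (rule DERIV_subset[OF f]) (use that assms(3) in auto)
      then show ?thesis
        by (simp add: has_field_derivative_def)
    qed
  qed (rule assms(4))
  then obtain r where r: "r \<in> {p..q}" "f q - f p = f' r * (q - p)"
    by blast
  moreover have "f' r * (q - p) \<le> C * (q - p)"
    using r(1) assms(4) by (intro mult_right_mono bound) auto
  ultimately show ?thesis
    by simp
qed

lemma integral_half_line_has_vector_derivative:
  fixes f :: "real \<Rightarrow> 'a::banach"
  assumes "continuous_on {0..} f" "0 \<le> t"
  shows "((\<lambda>t. integral {0..t} f) has_vector_derivative f t) (at t within {0..})"
proof -
  have "((\<lambda>t. integral {0..t} f) has_vector_derivative f t) (at t within {0..t + 1})"
    by (rule integral_has_vector_derivative) (use assms in \<open>auto intro: continuous_on_subset\<close>)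
  moreover have "at t within {0..t + 1} = at t within {0..}"
    by (rule at_within_nhd[of _ "{..<t + 1}"]) auto
  ultimately show ?thesis by simp
qed

lemma norm_integral_le_exp:
  fixes f :: "real \<Rightarrow> 'a::banach"
  assumes "continuous_on {0..} f" "\<And>r. 0 \<le> r \<Longrightarrow> norm (f r) \<le> B * exp (c * r)" "c > 0" "0 \<le> t"
  shows "norm (integral {0..t} f) \<le> B / c * exp (c * t)"
proof -
  have "norm (integral {0..t} f - integral {0..0} f) \<le> B / c * (exp (c * t) - exp (c * 0))"
    by (rule norm_increment_le_exp_increment)
       (use assms in \<open>auto intro: integral_half_line_has_vector_derivative\<close>)
  moreover have "0 \<le> B"
    using assms(2)[of 0] norm_ge_zero[of "f 0"] by (simp del: norm_ge_zero)
  ultimately show ?thesis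
    using assms(3) by (simp add: right_diff_distrib) (smt (verit) divide_nonneg_pos)
qed

text \<open>Existence on the whole half-line comes from one fixed point, with no gluing of local solutions.
With \<open>M\<close> a Lipschitz constant and \<open>c = 2 M\<close>, the unknown is the rescaled function
\<open>z t = exp (- c t) u t\<close>, which is bounded because solutions grow at most exponentially.
In the supremum norm of \<open>z\<close> the Picard operator contracts by the factor \<open>M / c = 1 / 2\<close>.\<close>

lemma lipschitz_ode_solution_exists:
  fixes F :: "'a::banach \<Rightarrow> 'a"
  assumes "L-lipschitz_on UNIV F"
  shows "\<exists>u. u 0 = u0 \<and> (\<forall>t\<ge>0. (u has_vector_derivative F (u t)) (at t within {0..}))"
proof -
  \<comment> \<open>a Lipschitz constant that is positive even if \<open>L = 0\<close>\<close>
  define M where "M = L + 1"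
  define c where "c = 2 * M"
  have M: "M > 0"
    using lipschitz_on_nonneg[OF assms] by (simp add: M_def)
  then have c: "c > 0"
    by (simp add: c_def)
  have lip: "M-lipschitz_on UNIV F"
    by (rule lipschitz_on_mono[OF assms]) (auto simp: M_def)
  have F_diff: "norm (F x - F y) \<le> M * norm (x - y)" for x y
    using lipschitz_on_normD[OF lip] by simp
  have F_cont [continuous_intros]: "continuous_on A (\<lambda>r. F (g r))" if "continuous_on A g" for A :: "real set" and g
    by (rule continuous_on_compose2[OF lipschitz_on_continuous_on[OF lip] that]) auto
  define f where "f z r = F (exp (c * r) *\<^sub>R apply_bcontfun z r)" for z :: "real \<Rightarrow>\<^sub>C 'a" and r
  \<comment> \<open>constant for negative times, so that it lives on all of \<open>\<real>\<close>, where bounded continuous functions are complete\<close>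
  define K where "K z t = exp (- c * max 0 t) *\<^sub>R (u0 + integral {0..max 0 t} (f z))" for z t
  have f_cont: "continuous_on A (f z)" for A z
    unfolding f_def by (intro continuous_intros continuous_on_apply_bcontfun)
  have f_diff: "norm (f z r - f w r) \<le> M * dist z w * exp (c * r)" for z w r
  proof -
    have "norm (f z r - f w r) \<le> M * norm (exp (c * r) *\<^sub>R (apply_bcontfun z r - apply_bcontfun w r))"
      using F_diff unfolding f_def by (simp add: scaleR_diff_right)
    also have "\<dots> = M * (exp (c * r) * dist (apply_bcontfun z r) (apply_bcontfun w r))"
      by (simp add: dist_norm)
    also have "\<dots> \<le> M * (exp (c * r) * dist z w)"
      using M by (intro mult_left_mono dist_bounded) auto
    finally show ?thesis by (simp add: algebra_simps)
  qed
  have f_bound: "norm (f z r) \<le> (norm (F 0) + M * norm z) * exp (c * r)" if "0 \<le> r" for z r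
  proof -
    have "norm (f z r) \<le> norm (f 0 r) + norm (f z r - f 0 r)"
      by (metis add.commute diff_add_cancel norm_triangle_ineq)
    also have "\<dots> \<le> norm (F 0) * exp (c * r) + M * norm z * exp (c * r)"
    proof (rule add_mono)
      show "norm (f 0 r) \<le> norm (F 0) * exp (c * r)"
        using that c mult_left_mono[of 1 "exp (c * r)" "norm (F 0)"] by (simp add: f_def)
      show "norm (f z r - f 0 r) \<le> M * norm z * exp (c * r)"
        using f_diff[of z r 0] by simp
    qed
    finally show ?thesis by (simp add: algebra_simps)
  qed
  have K_in: "K z \<in> bcontfun" for z
  proof (rule bcontfun_normI)
    have "continuous_on {0..} (\<lambda>t. integral {0..t} (f z))"
      by (rule half_line_continuous_on) (rule integral_half_line_has_vector_derivative[OF f_cont])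
    then have "continuous_on UNIV (\<lambda>t. integral {0..max 0 t} (f z))"
      by (rule continuous_on_compose2) (auto intro!: continuous_intros)
    then show "continuous_on UNIV (K z)"
      unfolding K_def by (intro continuous_intros)
    show "norm (K z t) \<le> norm u0 + (norm (F 0) + M * norm z) / c" for t
    proof -
      define \<tau> where "\<tau> = max 0 t"
      have "0 \<le> \<tau>" by (simp add: \<tau>_def)
      then have I: "norm (integral {0..\<tau>} (f z)) \<le> (norm (F 0) + M * norm z) / c * exp (c * \<tau>)"
        by (intro norm_integral_le_exp f_cont f_bound c)
      have "norm (K z t) = exp (- c * \<tau>) * norm (u0 + integral {0..\<tau>} (f z))"
        by (simp add: K_def \<tau>_def)
      also have "\<dots> \<le> exp (- c * \<tau>) * (norm u0 + (norm (F 0) + M * norm z) / c * exp (c * \<tau>))"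
        using norm_triangle_ineq[of u0 "integral {0..\<tau>} (f z)"] I by (intro mult_left_mono) auto
      also have "\<dots> = exp (- c * \<tau>) * norm u0 + (norm (F 0) + M * norm z) / c"
        by (simp add: algebra_simps exp_minus)
      also have "exp (- c * \<tau>) * norm u0 \<le> 1 * norm u0"
        using c \<open>0 \<le> \<tau>\<close> by (intro mult_right_mono) auto
      finally show ?thesis by simp
    qed
  qed
  have K_app: "apply_bcontfun (Bcontfun (K z)) = K z" for z
    by (rule Bcontfun_inverse[OF K_in])
  have "\<exists>!z. Bcontfun (K z) = z"
  proof (rule banach_fix_type[where c = "1 / 2"])
    show "\<forall>z w. dist (Bcontfun (K z)) (Bcontfun (K w)) \<le> 1 / 2 * dist z w"
    proof (intro allI dist_bound, unfold K_app)
      fix z w and t :: real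
      define \<tau> where "\<tau> = max 0 t"
      have \<tau>: "0 \<le> \<tau>" by (simp add: \<tau>_def)
      have int: "f z integrable_on {0..\<tau>}" "f w integrable_on {0..\<tau>}"
        by (intro integrable_continuous_interval f_cont)+
      have "dist (K z t) (K w t) = norm (exp (- c * \<tau>) *\<^sub>R integral {0..\<tau>} (\<lambda>r. f z r - f w r))"
        using int
        by (simp add: K_def dist_norm integral_diff scaleR_diff_right[symmetric] flip: \<tau>_def)
      also have "\<dots> = exp (- c * \<tau>) * norm (integral {0..\<tau>} (\<lambda>r. f z r - f w r))"
        by simp
      also have "\<dots> \<le> exp (- c * \<tau>) * (M * dist z w / c * exp (c * \<tau>))"
        by (intro mult_left_mono norm_integral_le_exp f_diff continuous_intros f_cont c \<tau>) auto
      also have "\<dots> = 1 / 2 * dist z w"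
        using M by (simp add: c_def exp_minus field_simps)
      finally show "dist (K z t) (K w t) \<le> 1 / 2 * dist z w" .
    qed
  qed auto
  then obtain z where z: "Bcontfun (K z) = z" by blast
  define u where "u t = exp (c * t) *\<^sub>R apply_bcontfun z t" for t
  have u_eq: "u t = u0 + integral {0..t} (f z)" if "0 \<le> t" for t
  proof -
    have "apply_bcontfun z t = K z t"
      using K_app z by metis
    then show ?thesis
      using that by (simp add: u_def K_def exp_minus)
  qed
  have "(u has_vector_derivative F (u t)) (at t within {0..})" if "0 \<le> t" for t
  proof (rule has_vector_derivative_transform)
    show "((\<lambda>t. u0 + integral {0..t} (f z)) has_vector_derivative F (u t)) (at t within {0..})"
      using integral_half_line_has_vector_derivative[OF f_cont that, of z]
      by (auto simp: f_def u_def intro!: derivative_eq_intros)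
  qed (use that u_eq in auto)
  moreover have "u 0 = u0"
    using u_eq[of 0] by simp
  ultimately show ?thesis by blast
qed

text \<open>The squared distance of two solutions grows at most at the rate \<open>2 L\<close>, so that after division by
\<open>exp (2 L t)\<close> it is nonincreasing; it starts at zero.\<close>

lemma lipschitz_ode_solution_unique:
  fixes F :: "'a::real_inner \<Rightarrow> 'a"
  assumes "L-lipschitz_on UNIV F"
    and u: "\<And>t. 0 \<le> t \<Longrightarrow> (u has_vector_derivative F (u t)) (at t within {0..})"
    and v: "\<And>t. 0 \<le> t \<Longrightarrow> (v has_vector_derivative F (v t)) (at t within {0..})"
    and "u 0 = v 0" "0 \<le> t"
  shows "u t = v t"
proof -
  define w where "w t = u t - v t" for t
  define g where "g t = exp (- 2 * L * t) * (w t \<bullet> w t)" for t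
  define g' where "g' t = exp (- 2 * L * t) * (2 * (w t \<bullet> (F (u t) - F (v t))) - 2 * L * (w t \<bullet> w t))" for t
  have w: "(w has_vector_derivative (F (u t) - F (v t))) (at t within {0..})" if "0 \<le> t" for t
    unfolding w_def by (intro has_vector_derivative_diff u v that)
  have "(g has_real_derivative g' t) (at t within {0..})" if "0 \<le> t" for t
  proof -
    have "((\<lambda>t. w t \<bullet> w t) has_vector_derivative (w t \<bullet> (F (u t) - F (v t)) + (F (u t) - F (v t)) \<bullet> w t)) (at t within {0..})"
      by (rule bounded_bilinear.has_vector_derivative[OF bounded_bilinear_inner w[OF that] w[OF that]])
    then show ?thesis
      unfolding g_def g'_def has_real_derivative_iff_has_vector_derivative[symmetric]
      by (auto intro!: derivative_eq_intros simp: inner_commute algebra_simps)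
  qed
  moreover have "g' r \<le> 0" for r
  proof -
    have "w r \<bullet> (F (u r) - F (v r)) \<le> norm (w r) * (L * norm (w r))"
      using lipschitz_on_normD[OF assms(1), of "u r" "v r"]
      by (intro order_trans[OF norm_cauchy_schwarz] mult_left_mono) (auto simp: w_def)
    also have "\<dots> = L * (w r \<bullet> w r)"
      by (simp add: dot_square_norm power2_eq_square)
    finally show ?thesis
      by (simp add: g'_def mult_le_0_iff)
  qed
  ultimately have "g t - g 0 \<le> 0 * (t - 0)"
    by (intro real_increment_le) (use assms in auto)
  then have "w t \<bullet> w t \<le> 0"
    using assms(4) by (simp add: g_def w_def mult_le_0_iff)
  then show ?thesis
    by (metis eq_iff_diff_eq_0 inner_eq_zero_iff inner_ge_zero order_antisym w_def)
qed

section \<open>Relaxation and Lyapunov decrease\<close>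

text \<open>Without forcing, \<open>w\<close> decays like \<open>exp (- t)\<close>; the forcing can hold it no farther from the origin
than its own size.  The proof integrates \<open>(exp t w)' = exp t h\<close>.\<close>

lemma forced_decay_bound:
  fixes w :: "real \<Rightarrow> 'a::real_normed_vector"
  assumes w: "\<And>t. 0 \<le> t \<Longrightarrow> (w has_vector_derivative h t - w t) (at t within {0..})"
    and h: "\<And>r. p \<le> r \<Longrightarrow> norm (h r) \<le> K"
    and "0 \<le> p" "p \<le> t"
  shows "norm (w t) \<le> exp (p - t) * norm (w p) + K"
proof -
  define y where "y t = exp t *\<^sub>R w t" for t :: real
  have "(y has_vector_derivative exp t *\<^sub>R h t) (at t within {0..})" if "0 \<le> t" for t
  proof -
    have "(exp has_real_derivative exp t) (at t within {0..})"
      by (auto intro!: derivative_eq_intros)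
    from has_vector_derivative_scaleR[OF this w[OF that]] show ?thesis
      by (simp add: y_def[abs_def] algebra_simps)
  qed
  then have "norm (y t - y p) \<le> K / 1 * (exp (1 * t) - exp (1 * p))"
    by (rule norm_increment_le_exp_increment) (use assms in auto)
  moreover have "0 \<le> K"
    using h[of p] norm_ge_zero[of "h p"] by (simp del: norm_ge_zero)
  then have "0 \<le> K * exp p" by simp
  moreover have "norm (y t) \<le> norm (y p) + norm (y t - y p)"
    by (metis add.commute diff_add_cancel norm_triangle_ineq)
  ultimately have "exp t * norm (w t) \<le> exp p * norm (w p) + K * exp t"
    by (simp add: y_def right_diff_distrib)
  then have "exp (- t) * (exp t * norm (w t)) \<le> exp (- t) * (exp p * norm (w p) + K * exp t)"
    by (intro mult_left_mono) auto
  then show ?thesis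
    by (simp add: exp_minus exp_diff field_simps)
qed

lemma forced_decay_tendsto_0:
  fixes w :: "real \<Rightarrow> 'a::real_normed_vector"
  assumes w: "\<And>t. 0 \<le> t \<Longrightarrow> (w has_vector_derivative h t - w t) (at t within {0..})"
    and h: "(h \<longlongrightarrow> 0) at_top"
  shows "(w \<longlongrightarrow> 0) at_top"
proof (rule tendstoI)
  fix e :: real assume "0 < e"
  then have "eventually (\<lambda>t. dist (h t) 0 < e / 2) at_top"
    using tendstoD[OF h, of "e / 2"] by simp
  then obtain q where q: "\<And>r. q \<le> r \<Longrightarrow> norm (h r) < e / 2"
    by (auto simp: eventually_at_top_linorder)
  define p where "p = max 0 q"
  have "((\<lambda>t. exp p * exp (- t) * norm (w p)) \<longlongrightarrow> exp p * 0 * norm (w p)) at_top"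
    by (intro tendsto_intros filterlim_compose[OF exp_at_bot filterlim_uminus_at_bot_at_top])
  then have "((\<lambda>t. exp (p - t) * norm (w p)) \<longlongrightarrow> 0) at_top"
    by (simp add: exp_minus exp_diff divide_inverse)
  then have "eventually (\<lambda>t. dist (exp (p - t) * norm (w p)) 0 < e / 2) at_top"
    using \<open>0 < e\<close> by (intro tendstoD) auto
  then show "eventually (\<lambda>t. dist (w t) 0 < e) at_top"
    using eventually_ge_at_top[of p]
  proof eventually_elim
    case (elim t)
    have "norm (w t) \<le> exp (p - t) * norm (w p) + e / 2"
    proof (rule forced_decay_bound[OF w])
      show "norm (h r) \<le> e / 2" if "p \<le> r" for r
        using q[of r] that by (simp add: p_def)
    qed (use elim in \<open>auto simp: p_def\<close>)
    then show ?case
      using elim by simp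
  qed
qed

text \<open>If \<open>x\<close> were at distance \<open>e\<close> from \<open>l\<close> at arbitrarily late times, then, as its speed is
bounded, each such time would begin an interval of fixed length \<open>\<tau>\<close> on which the distance stays
above \<open>e / 2\<close>.  Each of these intervals costs \<open>D\<close> the fixed amount \<open>d \<tau>\<close>, and a
nonnegative \<open>D\<close> cannot pay for infinitely many.\<close>

lemma tendsto_of_lyapunov_decrease:
  fixes x :: "real \<Rightarrow> 'a::metric_space" and D :: "real \<Rightarrow> real"
  assumes lip: "\<And>p q. 0 \<le> p \<Longrightarrow> p \<le> q \<Longrightarrow> dist (x q) (x p) \<le> K * (q - p)"
    and mono: "\<And>p q. 0 \<le> p \<Longrightarrow> p \<le> q \<Longrightarrow> D q \<le> D p"
    and nonneg: "\<And>t. 0 \<le> t \<Longrightarrow> 0 \<le> D t"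
    and decrease: "\<And>e. 0 < e \<Longrightarrow> \<exists>d>0. \<forall>p q. 0 \<le> p \<longrightarrow> p \<le> q \<longrightarrow>
      (\<forall>t\<in>{p..q}. e \<le> dist (x t) l) \<longrightarrow> D q \<le> D p - d * (q - p)"
  shows "(x \<longlongrightarrow> l) at_top"
proof (rule tendstoI, rule ccontr)
  fix e :: real assume e: "0 < e" and "\<not> eventually (\<lambda>t. dist (x t) l < e) at_top"
  then have far: "\<exists>t\<ge>N. e \<le> dist (x t) l" for N
    by (auto simp: eventually_at_top_linorder not_less)
  obtain d where d: "d > 0" and dec: "\<And>p q. 0 \<le> p \<Longrightarrow> p \<le> q \<Longrightarrow>
      (\<And>t. t\<in>{p..q} \<Longrightarrow> e / 2 \<le> dist (x t) l) \<Longrightarrow> D q \<le> D p - d * (q - p)"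
    using decrease[of "e / 2"] e by auto
  \<comment> \<open>in time \<open>\<tau>\<close> the function \<open>x\<close> moves by at most \<open>e / 2\<close>\<close>
  define \<tau> where "\<tau> = e / (2 * (\<bar>K\<bar> + 1))"
  have \<tau>: "\<tau> > 0"
    using e by (simp add: \<tau>_def)
  have K\<tau>: "K * r \<le> e / 2" if "0 \<le> r" "r \<le> \<tau>" for r
  proof -
    have "K * r \<le> (\<bar>K\<bar> + 1) * \<tau>"
      using that by (intro mult_mono) auto
    also have "\<dots> = e / 2"
      by (simp add: \<tau>_def field_simps)
    finally show ?thesis .
  qed
  have drop: "\<exists>t\<ge>0. D t \<le> D 0 - real k * (d * \<tau>)" for k
  proof (induction k)
    case 0
    show ?case by auto
  next
    case (Suc k)
    then obtain t where t: "0 \<le> t" "D t \<le> D 0 - real k * (d * \<tau>)" by blast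
    obtain p where p: "t \<le> p" "e \<le> dist (x p) l"
      using far by blast
    have "D (p + \<tau>) \<le> D p - d * (p + \<tau> - p)"
    proof (rule dec)
      fix r assume r: "r \<in> {p..p + \<tau>}"
      have "dist (x r) (x p) \<le> K * (r - p)"
        using lip[of p r] r t p by simp
      also have "\<dots> \<le> e / 2"
        using r by (intro K\<tau>) auto
      finally show "e / 2 \<le> dist (x r) l"
        using p dist_triangle[of "x p" l "x r"] by (simp add: dist_commute)
    qed (use t p \<tau> in auto)
    moreover have "D p \<le> D t"
      using mono t p by simp
    ultimately show ?case
      using t p \<tau> by (intro exI[of _ "p + \<tau>"]) (auto simp: algebra_simps)
  qed
  obtain k where "real k * (d * \<tau>) > D 0"
    using d \<tau> ex_less_of_nat_mult[of "d * \<tau>" "D 0"] by auto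
  then show False
    using drop[of k] nonneg by fastforce
qed

section \<open>A criterion for differentiability\<close>

text \<open>The activation has kinks, so the derivative of half its square cannot come from the chain rule.
It is obtained from convexity instead: two opposite subgradient inequalities squeeze the
first-order remainder between \<open>0\<close> and \<open>(y - x)\<^sup>2\<close>.\<close>

lemma has_real_derivative_of_lipschitz_subgradient:
  fixes f g :: "real \<Rightarrow> real"
  assumes sub: "\<And>x y. g x * (y - x) \<le> f y - f x"
    and lip: "\<And>x y. \<bar>g x - g y\<bar> \<le> \<bar>x - y\<bar>"
  shows "(f has_real_derivative g x) (at x)"
proof -
  have bound: "norm ((f y - f x) / (y - x) - g x) \<le> \<bar>y - x\<bar>" if "y \<noteq> x" for y
  proof -
    have "0 \<le> f y - f x - g x * (y - x)"
      using sub[of x y] by simp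
    moreover have "f y - f x - g x * (y - x) \<le> (g y - g x) * (y - x)"
      using sub[of y x] by (simp add: algebra_simps)
    moreover have "(g y - g x) * (y - x) \<le> \<bar>y - x\<bar> * \<bar>y - x\<bar>"
      using mult_right_mono[OF lip[of y x], of "\<bar>y - x\<bar>"] by (simp add: abs_mult[symmetric])
    ultimately have "\<bar>f y - f x - g x * (y - x)\<bar> \<le> \<bar>y - x\<bar> * \<bar>y - x\<bar>"
      by linarith
    moreover have "(f y - f x) / (y - x) - g x = (f y - f x - g x * (y - x)) / (y - x)"
      using that by (simp add: field_simps)
    ultimately show ?thesis
      using that by (simp add: abs_divide pos_divide_le_eq)
  qed
  have "((\<lambda>y. (f y - f x) / (y - x) - g x) \<longlongrightarrow> 0) (at x)"
  proof (rule Lim_null_comparison)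
    show "eventually (\<lambda>y. norm ((f y - f x) / (y - x) - g x) \<le> \<bar>y - x\<bar>) (at x)"
      using bound by (auto simp: eventually_at_filter)
    have "((\<lambda>y. \<bar>y - x\<bar>) \<longlongrightarrow> \<bar>x - x\<bar>) (at x)"
      by (intro tendsto_intros)
    then show "((\<lambda>y. \<bar>y - x\<bar>) \<longlongrightarrow> 0) (at x)"
      by simp
  qed
  then show ?thesis
    unfolding has_field_derivative_iff using Lim_null by blast
qed

section \<open>The activation function\<close>

text \<open>Together with the next lemma, this says that the residual \<open>x - T x\<close> is a subgradient of
\<open>c \<mapsto> lam * \<bar>c\<bar>\<close> at \<open>T x\<close>, relative to the feasible half-line in the constrained case.  Through
these two facts LASSO and CLASSO are treated at once.\<close>

lemma residual_mult_le:
  assumes "lam > 0" "P = CLASSO \<Longrightarrow> 0 \<le> c"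
  shows "(x - activation P lam x) * c \<le> lam * \<bar>c\<bar>"
proof (cases P)
  case LASSO
  then have "\<bar>x - activation P lam x\<bar> \<le> lam"
    using assms(1) by (auto simp: threshold_def)
  then have "\<bar>x - activation P lam x\<bar> * \<bar>c\<bar> \<le> lam * \<bar>c\<bar>"
    by (rule mult_right_mono) simp
  then show ?thesis
    by (simp add: abs_mult[symmetric])
next
  case CLASSO
  then have "x - activation P lam x \<le> lam"
    using assms(1) by (auto simp: threshold_def)
  then show ?thesis
    using assms(2) CLASSO by (simp add: mult_right_mono)
qed

lemma residual_mult_activation:
  assumes "lam > 0"
  shows "(x - activation P lam x) * activation P lam x = lam * \<bar>activation P lam x\<bar>"
  using assms by (cases P) (auto simp: threshold_def algebra_simps)

lemma activation_nonexpansive: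
  assumes "lam > 0"
  shows "\<bar>activation P lam x - activation P lam y\<bar> \<le> \<bar>x - y\<bar>"
  using assms by (cases P) (auto simp: threshold_def)

text \<open>This is what makes a differentiable Lyapunov function possible: the activation itself has kinks,
but it is the derivative of a convex function.\<close>

lemma half_square_activation_has_derivative:
  assumes "lam > 0"
  shows "((\<lambda>x. (activation P lam x)\<^sup>2 / 2) has_real_derivative activation P lam x) (at x)"
proof (rule has_real_derivative_of_lipschitz_subgradient)
  fix x y
  define a b where "a = activation P lam x" and "b = activation P lam y"
  have "(y - b) * a \<le> lam * \<bar>a\<bar>" "(x - a) * a = lam * \<bar>a\<bar>"
    unfolding a_def b_def
    using assms by (auto intro!: residual_mult_le residual_mult_activation simp: threshold_def)
  moreover have "b\<^sup>2 / 2 - a\<^sup>2 / 2 - a * (y - x) = (b - a)\<^sup>2 / 2 + ((x - a) * a - (y - b) * a)"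
    by (simp add: power2_eq_square field_simps)
  moreover have "0 \<le> (b - a)\<^sup>2 / 2"
    by simp
  ultimately show "activation P lam x * (y - x)
      \<le> (activation P lam y)\<^sup>2 / 2 - (activation P lam x)\<^sup>2 / 2"
    unfolding a_def[symmetric] b_def[symmetric] by linarith
qed (rule activation_nonexpansive[OF assms])

lemma activation_vec_feasible: "activation_vec P lam u \<in> feasible P"
  by (cases P) (auto simp: activation_vec_def threshold_def)

lemma residual_inner_le:
  assumes "lam > 0" "c \<in> feasible P"
  shows "(u - activation_vec P lam u) \<bullet> c \<le> lam * l1_norm c"
  unfolding inner_vec_def l1_norm_def sum_distrib_left
proof (rule sum_mono)
  fix i
  have "0 \<le> c $ i" if "P = CLASSO"
    using assms(2) that by simp
  then show "(u - activation_vec P lam u) $ i \<bullet> c $ i \<le> lam * \<bar>c $ i\<bar>"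
    using residual_mult_le[OF assms(1)] by (simp add: activation_vec_def)
qed

lemma residual_inner_activation:
  assumes "lam > 0"
  shows "(u - activation_vec P lam u) \<bullet> activation_vec P lam u = lam * l1_norm (activation_vec P lam u)"
  using residual_mult_activation[OF assms]
  by (simp add: inner_vec_def l1_norm_def sum_distrib_left activation_vec_def)

lemma activation_vec_nonexpansive:
  assumes "lam > 0"
  shows "dist (activation_vec P lam u) (activation_vec P lam v) \<le> dist u v"
  unfolding dist_norm
  by (rule norm_le_componentwise_cart) (simp add: activation_vec_def activation_nonexpansive[OF assms])

section \<open>Energy and the Bregman gap\<close>

text \<open>The position towards which LCA relaxes while the activations are held at \<open>a\<close>.\<close>

definition drive :: "real ^ 'n ^ 'm \<Rightarrow> real ^ 'm \<Rightarrow> real ^ 'n \<Rightarrow> real ^ 'n" where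
  "drive \<Phi> s a = transpose \<Phi> *v s - (transpose \<Phi> ** \<Phi> - mat 1) *v a"

lemma lca_field_eq_drive:
  "lca_field P \<Phi> s lam u = drive \<Phi> s (activation_vec P lam u) - u"
  by (simp add: lca_field_def drive_def)

lemma drive_eq: "drive \<Phi> s a = transpose \<Phi> *v (s - \<Phi> *v a) + a"
  by (simp add: drive_def matrix_vector_mult_diff_rdistrib matrix_vector_mult_diff_distrib
      matrix_vector_mul_assoc)

text \<open>The field \<open>F u = \<Phi>\<^sup>T (s - \<Phi> a) - (u - a)\<close> is the negative of a subgradient of the energy at
\<open>a = T u\<close>, because \<open>u - a\<close> is a subgradient of the penalty there.  The claim is the subgradient
inequality of the convex energy.\<close>

lemma inner_lca_field_le_energy_gap:
  assumes "lam > 0" "c \<in> feasible P"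
  shows "(activation_vec P lam u - c) \<bullet> lca_field P \<Phi> s lam u
    \<le> energy \<Phi> s lam c - energy \<Phi> s lam (activation_vec P lam u)"
proof -
  define a where "a = activation_vec P lam u"
  define r where "r = s - \<Phi> *v a"
  define p where "p = \<Phi> *v (c - a)"
  have field: "lca_field P \<Phi> s lam u = transpose \<Phi> *v r - (u - a)"
    by (simp add: lca_field_eq_drive drive_eq r_def flip: a_def)
  have "(a - c) \<bullet> (transpose \<Phi> *v r) = - (p \<bullet> r)"
  proof -
    have "(a - c) \<bullet> (transpose \<Phi> *v r) = (\<Phi> *v (a - c)) \<bullet> r"
      by (metis dot_lmul_matrix inner_commute transpose_matrix_vector)
    also have "\<Phi> *v (a - c) = - p"
      by (simp add: p_def matrix_vector_mult_diff_distrib)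
    finally show ?thesis by simp
  qed
  moreover have "(a - c) \<bullet> (u - a) \<ge> lam * l1_norm a - lam * l1_norm c"
    using residual_inner_le[OF assms, of u] residual_inner_activation[OF assms(1), of u P]
    by (simp add: inner_diff_left inner_commute flip: a_def)
  moreover have "s - \<Phi> *v c = r - p"
    by (simp add: r_def p_def matrix_vector_mult_diff_distrib)
  then have "(norm (s - \<Phi> *v c))\<^sup>2 = (norm r)\<^sup>2 - 2 * (p \<bullet> r) + p \<bullet> p"
    by (simp add: power2_norm_eq_inner inner_diff_left inner_diff_right inner_commute)
  moreover have "0 \<le> p \<bullet> p" by simp
  moreover have "(a - c) \<bullet> (transpose \<Phi> *v r - (u - a))
      = (a - c) \<bullet> (transpose \<Phi> *v r) - (a - c) \<bullet> (u - a)"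
    by (rule inner_diff_right)
  ultimately show ?thesis
    unfolding energy_def field a_def[symmetric] r_def[symmetric] by linarith
qed

text \<open>Up to the constant \<open>lam * l1_norm c + (norm c)\<^sup>2 / 2\<close>, this is \<open>(norm (T u))\<^sup>2 / 2 - c \<bullet> u\<close>, a
function with gradient \<open>T u - c\<close>.  The form chosen here shows how it controls the distance of the
activation from \<open>c\<close>: the term in parentheses is nonnegative for feasible \<open>c\<close>.\<close>

definition bregman_gap :: "problem \<Rightarrow> real \<Rightarrow> real ^ 'n \<Rightarrow> real ^ 'n \<Rightarrow> real" where
  "bregman_gap P lam c u = (norm (activation_vec P lam u - c))\<^sup>2 / 2
     + (lam * l1_norm c - (u - activation_vec P lam u) \<bullet> c)"

lemma half_dist_square_le_bregman_gap:
  assumes "lam > 0" "c \<in> feasible P"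
  shows "(dist (activation_vec P lam u) c)\<^sup>2 / 2 \<le> bregman_gap P lam c u"
  using residual_inner_le[OF assms, of u] by (simp add: bregman_gap_def dist_norm)

lemma bregman_gap_has_derivative:
  assumes "lam > 0" and u: "(u has_vector_derivative u') (at t within S)"
  shows "((\<lambda>t. bregman_gap P lam c (u t)) has_real_derivative
    (activation_vec P lam (u t) - c) \<bullet> u') (at t within S)"
proof -
  have comp: "((\<lambda>t. u t $ i) has_real_derivative u' $ i) (at t within S)" for i
    unfolding has_real_derivative_iff_has_vector_derivative
    by (rule bounded_linear.has_vector_derivative[OF bounded_linear_vec_nth u])
  have "bregman_gap P lam c (u t) = (\<Sum>i\<in>UNIV. (activation P lam (u t $ i))\<^sup>2 / 2 - c $ i * u t $ i)
      + ((norm c)\<^sup>2 / 2 + lam * l1_norm c)" for t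
  proof -
    have "bregman_gap P lam c (u t) = activation_vec P lam (u t) \<bullet> activation_vec P lam (u t) / 2
        - c \<bullet> u t + ((norm c)\<^sup>2 / 2 + lam * l1_norm c)"
      by (simp add: bregman_gap_def power2_norm_eq_inner inner_diff_left inner_diff_right
          inner_commute field_simps)
    then show ?thesis
      by (simp add: inner_vec_def activation_vec_def power2_eq_square sum_subtractf sum_divide_distrib)
  qed
  moreover have "((\<lambda>t. (\<Sum>i\<in>UNIV. (activation P lam (u t $ i))\<^sup>2 / 2 - c $ i * u t $ i)
      + ((norm c)\<^sup>2 / 2 + lam * l1_norm c)) has_real_derivative
      (\<Sum>i\<in>UNIV. activation P lam (u t $ i) * u' $ i - c $ i * u' $ i) + 0) (at t within S)"
    by (intro DERIV_add DERIV_sum DERIV_diff DERIV_const DERIV_cmult comp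
        DERIV_chain2[OF half_square_activation_has_derivative[OF assms(1)]])
  moreover have "(\<Sum>i\<in>UNIV. activation P lam (u t $ i) * u' $ i - c $ i * u' $ i) + 0
      = (activation_vec P lam (u t) - c) \<bullet> u'"
    by (simp add: inner_vec_def activation_vec_def left_diff_distrib)
  ultimately show ?thesis by simp
qed

section \<open>Optimal solutions\<close>

lemma continuous_on_energy [continuous_intros]:
  "continuous_on A g \<Longrightarrow> continuous_on A (\<lambda>x. energy \<Phi> s lam (g x))"
  unfolding energy_def l1_norm_def
  by (intro continuous_intros bounded_linear.continuous_on[OF matrix_vector_mul_bounded_linear])

lemma optimal_solution_minimizes:
  assumes "c \<in> optimal_solutions P \<Phi> s lam"
  shows "c \<in> feasible P" "a \<in> feasible P \<Longrightarrow> energy \<Phi> s lam c \<le> energy \<Phi> s lam a"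
  using assms by (auto simp: optimal_solutions_def is_arg_min_def not_less)

lemma closed_feasible: "closed (feasible P)"
  by (cases P) (auto simp: Collect_all_eq intro!: closed_INT closed_Collect_le continuous_intros)

text \<open>This is where uniqueness of the optimum enters: on the compact set of feasible points between the
distances \<open>e\<close> and \<open>R\<close> from the optimum \<open>c\<close>, the energy attains its minimum, which must exceed the
optimal value.\<close>

lemma unique_optimum_energy_gap:
  assumes opt: "optimal_solutions P \<Phi> s lam = {c}" and "0 < e"
  shows "\<exists>d>0. \<forall>a\<in>feasible P. e \<le> dist a c \<longrightarrow> dist a c \<le> R \<longrightarrow>
    energy \<Phi> s lam c + d \<le> energy \<Phi> s lam a"
proof -
  define A where "A = feasible P \<inter> {a. e \<le> dist a c} \<inter> cball c R"
  have c: "c \<in> feasible P" "\<And>a. a \<in> feasible P \<Longrightarrow> energy \<Phi> s lam c \<le> energy \<Phi> s lam a"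
    using optimal_solution_minimizes[of c P \<Phi> s lam] opt by auto
  show ?thesis
  proof (cases "A = {}")
    case True
    then show ?thesis
      by (intro exI[of _ 1]) (auto simp: A_def dist_commute)
  next
    case False
    have "compact A"
      unfolding A_def
      by (intro closed_Int_compact closed_Int closed_feasible compact_cball closed_Collect_le
          continuous_intros)
    then obtain a where a: "a \<in> A" "\<And>b. b \<in> A \<Longrightarrow> energy \<Phi> s lam a \<le> energy \<Phi> s lam b"
      using continuous_attains_inf[OF _ False, of "energy \<Phi> s lam"] continuous_on_energy[OF continuous_on_id]
      by blast
    have "energy \<Phi> s lam c < energy \<Phi> s lam a"
    proof (rule ccontr)
      assume "\<not> ?thesis"
      then have "energy \<Phi> s lam a \<le> energy \<Phi> s lam b" if "b \<in> feasible P" for b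
        using c(2)[OF that] by simp
      then have "a \<in> optimal_solutions P \<Phi> s lam"
        using a(1) by (auto simp: optimal_solutions_def is_arg_min_def A_def not_less)
      then show False
        using a(1) opt \<open>0 < e\<close> by (simp add: A_def)
    qed
    then show ?thesis
      using a(2)
      by (intro exI[of _ "energy \<Phi> s lam a - energy \<Phi> s lam c"]) (auto simp: A_def dist_commute)
  qed
qed

section \<open>The LCA flow\<close>

lemma continuous_on_drive [continuous_intros]:
  "continuous_on A g \<Longrightarrow> continuous_on A (\<lambda>x. drive \<Phi> s (g x))"
  unfolding drive_def
  by (intro continuous_intros bounded_linear.continuous_on[OF matrix_vector_mul_bounded_linear])

lemma lca_field_lipschitz:
  fixes \<Phi> :: "real ^ 'n ^ 'm"
  assumes "lam > 0"
  shows "\<exists>L. L-lipschitz_on UNIV (lca_field P \<Phi> s lam)"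
proof -
  define G where "G = transpose \<Phi> ** \<Phi> - mat 1"
  show ?thesis
  proof (intro exI lipschitz_onI)
    show "0 \<le> 1 + onorm ((*v) G)"
      using onorm_pos_le[OF matrix_vector_mul_bounded_linear[of G]] by simp
    fix u v :: "real ^ 'n"
    define x y where "x = activation_vec P lam u" and "y = activation_vec P lam v"
    have "lca_field P \<Phi> s lam u - lca_field P \<Phi> s lam v = (v - u) - G *v (x - y)"
      by (simp add: lca_field_def G_def x_def y_def matrix_vector_mult_diff_distrib)
    then have "dist (lca_field P \<Phi> s lam u) (lca_field P \<Phi> s lam v)
        \<le> norm (v - u) + norm (G *v (x - y))"
      by (simp only: dist_norm norm_triangle_ineq4)
    also have "norm (G *v (x - y)) \<le> onorm ((*v) G) * norm (x - y)"
      by (rule onorm) (rule matrix_vector_mul_bounded_linear)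
    also have "\<dots> \<le> onorm ((*v) G) * dist u v"
      using activation_vec_nonexpansive[OF assms, of P u v]
      by (intro mult_left_mono onorm_pos_le matrix_vector_mul_bounded_linear)
        (simp add: x_def y_def dist_norm)
    finally show "dist (lca_field P \<Phi> s lam u) (lca_field P \<Phi> s lam v)
        \<le> (1 + onorm ((*v) G)) * dist u v"
      by (simp add: dist_norm norm_minus_commute algebra_simps)
  qed
qed

lemma lca_solution_exists:
  assumes "lam > 0"
  shows "\<exists>u. lca_solution P \<Phi> s lam u0 u"
  using lca_field_lipschitz[OF assms] lipschitz_ode_solution_exists
  unfolding lca_solution_def by blast

lemma lca_flow_eq_solution:
  assumes "lam > 0" and u: "lca_solution P \<Phi> s lam u0 u" and "0 \<le> t"
  shows "lca_flow P \<Phi> s lam t u0 = u t"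
  unfolding lca_flow_def
proof (rule the_equality)
  show "\<exists>v. lca_solution P \<Phi> s lam u0 v \<and> v t = u t"
    using u by blast
next
  fix x assume "\<exists>v. lca_solution P \<Phi> s lam u0 v \<and> v t = x"
  then obtain v where v: "lca_solution P \<Phi> s lam u0 v" "v t = x" by blast
  obtain L where "L-lipschitz_on UNIV (lca_field P \<Phi> s lam)"
    using lca_field_lipschitz[OF assms(1)] by blast
  then have "v t = u t"
    by (rule lipschitz_ode_solution_unique) (use u v assms(3) in \<open>auto simp: lca_solution_def\<close>)
  then show "x = u t"
    using v(2) by simp
qed

section \<open>Convergence\<close>

text \<open>The initial value of the Bregman gap confines the activation to a ball around the optimum.
On that ball the drive is bounded, hence so are the state (by relaxation) and its velocity.\<close>

lemma activation_vec_bounded_by_initial_gap: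
  assumes "lam > 0" "c \<in> feasible P" "bregman_gap P lam c u \<le> D"
  shows "dist (activation_vec P lam u) c \<le> sqrt (2 * D)"
  using half_dist_square_le_bregman_gap[OF assms(1,2), of u] assms(3)
  by (intro real_le_rsqrt) simp

lemma lca_solution_velocity_bounded:
  assumes u: "\<And>t. 0 \<le> t \<Longrightarrow> (u has_vector_derivative lca_field P \<Phi> s lam (u t)) (at t within {0..})"
    and bounded: "\<And>t. 0 \<le> t \<Longrightarrow> dist (activation_vec P lam (u t)) c \<le> R"
  shows "\<exists>M. \<forall>t\<ge>0. norm (lca_field P \<Phi> s lam (u t)) \<le> M"
proof -
  have "bounded (drive \<Phi> s ` cball c R)"
    by (intro compact_imp_bounded compact_continuous_image continuous_on_drive
        continuous_on_id compact_cball)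
  then obtain K where K: "\<And>a. dist a c \<le> R \<Longrightarrow> norm (drive \<Phi> s a) \<le> K"
    unfolding bounded_iff by (metis dist_commute imageI mem_cball)
  have drive: "norm (drive \<Phi> s (activation_vec P lam (u t))) \<le> K" if "0 \<le> t" for t
    using K bounded[OF that] .
  have "norm (lca_field P \<Phi> s lam (u t)) \<le> K + (norm (u 0) + K)" if "0 \<le> t" for t
  proof -
    have "norm (u t) \<le> exp (0 - t) * norm (u 0) + K"
      by (rule forced_decay_bound[where h = "\<lambda>t. drive \<Phi> s (activation_vec P lam (u t))"])
        (use u drive that in \<open>simp_all add: lca_field_eq_drive\<close>)
    also have "exp (0 - t) * norm (u 0) \<le> 1 * norm (u 0)"
      using that by (intro mult_right_mono) auto
    finally have "norm (u t) \<le> norm (u 0) + K" by simp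
    then show ?thesis
      unfolding lca_field_eq_drive
      using norm_triangle_ineq4[of "drive \<Phi> s (activation_vec P lam (u t))" "u t"] drive[OF that]
      by linarith
  qed
  then show ?thesis by blast
qed

text \<open>Here all parts of the Lyapunov argument meet: the Bregman gap to the optimum decreases at
least at the rate by which the energy of the activation exceeds the optimal energy, and this rate
is bounded below as long as the activation stays away from the optimum.\<close>

lemma activation_vec_tendsto_optimum:
  assumes "lam > 0" and opt: "optimal_solutions P \<Phi> s lam = {c}"
    and u: "\<And>t. 0 \<le> t \<Longrightarrow> (u has_vector_derivative lca_field P \<Phi> s lam (u t)) (at t within {0..})"
  shows "((\<lambda>t. activation_vec P lam (u t)) \<longlongrightarrow> c) at_top"
proof -
  define a where "a t = activation_vec P lam (u t)" for t
  define D where "D t = bregman_gap P lam c (u t)" for t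
  define D' where "D' t = (a t - c) \<bullet> lca_field P \<Phi> s lam (u t)" for t
  have a_feas: "a t \<in> feasible P" for t
    by (simp add: a_def activation_vec_feasible)
  have c: "c \<in> feasible P" "\<And>b. b \<in> feasible P \<Longrightarrow> energy \<Phi> s lam c \<le> energy \<Phi> s lam b"
    using optimal_solution_minimizes[of c P \<Phi> s lam] opt by auto
  have D: "(D has_real_derivative D' t) (at t within {0..})" if "0 \<le> t" for t
    unfolding D_def[abs_def] D'_def a_def
    by (rule bregman_gap_has_derivative[OF assms(1) u[OF that]])
  have D'_le: "D' t \<le> energy \<Phi> s lam c - energy \<Phi> s lam (a t)" for t
    unfolding D'_def a_def by (rule inner_lca_field_le_energy_gap[OF assms(1) c(1)])
  have D_mono: "D q \<le> D p" if "0 \<le> p" "p \<le> q" for p q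
  proof -
    have "D q - D p \<le> 0 * (q - p)"
    proof (rule real_increment_le[OF D _ that])
      show "D' r \<le> 0" for r
        using D'_le[of r] c(2)[OF a_feas] by (meson diff_le_0_iff_le order_trans)
    qed
    then show ?thesis by simp
  qed
  have D_nonneg: "0 \<le> D t" for t
    unfolding D_def
    by (rule order_trans[OF _ half_dist_square_le_bregman_gap[OF assms(1) c(1)]]) simp
  define R where "R = sqrt (2 * D 0)"
  have a_bounded: "dist (a t) c \<le> R" if "0 \<le> t" for t
    unfolding a_def R_def
    by (rule activation_vec_bounded_by_initial_gap[OF assms(1) c(1)])
      (use D_mono[of 0 t] that in \<open>simp add: D_def\<close>)
  obtain M where M: "\<And>t. 0 \<le> t \<Longrightarrow> norm (lca_field P \<Phi> s lam (u t)) \<le> M"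
    using lca_solution_velocity_bounded[OF u a_bounded[unfolded a_def]] by blast
  have "(a \<longlongrightarrow> c) at_top"
  proof (rule tendsto_of_lyapunov_decrease[where D = D])
    fix p q :: real assume pq: "0 \<le> p" "p \<le> q"
    have "norm (u q - u p) \<le> M * q - M * p"
    proof (rule norm_increment_le_increment[OF u _ _ pq])
      show "((\<lambda>r. M * r) has_real_derivative M) (at r)" for r
        using DERIV_cmult[OF DERIV_ident, of M r] by simp
      show "norm (lca_field P \<Phi> s lam (u r)) \<le> M" if "p \<le> r" for r
        using M that pq by simp
    qed
    then show "dist (a q) (a p) \<le> M * (q - p)"
      using activation_vec_nonexpansive[OF assms(1), of P "u q" "u p"]
      by (simp add: a_def dist_norm right_diff_distrib)
  next
    fix e :: real assume "0 < e"
    then obtain d where d: "d > 0" "\<And>b. b \<in> feasible P \<Longrightarrow> e \<le> dist b c \<Longrightarrow> dist b c \<le> R \<Longrightarrow>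
        energy \<Phi> s lam c + d \<le> energy \<Phi> s lam b"
      using unique_optimum_energy_gap[OF opt, of e R] by blast
    have "D q \<le> D p - d * (q - p)"
      if pq: "0 \<le> p" "p \<le> q" and far: "\<forall>t\<in>{p..q}. e \<le> dist (a t) c" for p q
    proof -
      have "D q - D p \<le> - d * (q - p)"
      proof (rule real_increment_le[OF D _ pq])
        show "D' r \<le> - d" if "p \<le> r" "r \<le> q" for r
        proof -
          have "energy \<Phi> s lam c + d \<le> energy \<Phi> s lam (a r)"
            using that far pq by (intro d(2) a_feas a_bounded) auto
          then show ?thesis
            using D'_le[of r] by linarith
        qed
      qed
      then show ?thesis by simp
    qed
    then show "\<exists>d>0. \<forall>p q. 0 \<le> p \<longrightarrow> p \<le> q \<longrightarrow>
        (\<forall>t\<in>{p..q}. e \<le> dist (a t) c) \<longrightarrow> D q \<le> D p - d * (q - p)"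
      using d(1) by blast
  qed (use D_mono D_nonneg in auto)
  then show ?thesis
    by (simp add: a_def[abs_def])
qed

theorem theorem8:
  fixes P :: problem
    and \<Phi> :: "real ^ 'n ^ 'm"
    and s :: "real ^ 'm"
    and lam :: real
    and a_star u0 :: "real ^ 'n"
  assumes "lam > 0"
    and "\<forall>j. norm (column j \<Phi>) = 1"
    and "optimal_solutions P \<Phi> s lam = {a_star}"
  shows "\<exists>u_star \<in> lca_fixed_points P \<Phi> s lam.
           ((\<lambda>t. lca_flow P \<Phi> s lam t u0) \<longlongrightarrow> u_star) at_top \<and>
           activation_vec P lam u_star = a_star"
proof -
  obtain u where sol: "lca_solution P \<Phi> s lam u0 u"
    using lca_solution_exists[OF assms(1)] by blast
  then have u: "(u has_vector_derivative lca_field P \<Phi> s lam (u t)) (at t within {0..})" if "0 \<le> t" for t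
    using that by (simp add: lca_solution_def)
  have a_lim: "((\<lambda>t. activation_vec P lam (u t)) \<longlongrightarrow> a_star) at_top"
    by (rule activation_vec_tendsto_optimum[OF assms(1,3) u])
  define u_star where "u_star = drive \<Phi> s a_star"
  define h where "h t = drive \<Phi> s (activation_vec P lam (u t)) - u_star" for t
  have "isCont (drive \<Phi> s) a_star"
    using continuous_on_drive[OF continuous_on_id, of UNIV \<Phi> s] by (simp add: continuous_on_eq_continuous_at)
  then have "((\<lambda>t. drive \<Phi> s (activation_vec P lam (u t))) \<longlongrightarrow> u_star) at_top"
    unfolding u_star_def using a_lim by (rule isCont_tendsto_compose)
  then have "(h \<longlongrightarrow> 0) at_top"
    unfolding h_def[abs_def] by (rule LIM_zero)
  then have "((\<lambda>t. u t - u_star) \<longlongrightarrow> 0) at_top"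
  proof (rule forced_decay_tendsto_0[rotated])
    show "((\<lambda>t. u t - u_star) has_vector_derivative h t - (u t - u_star)) (at t within {0..})"
      if "0 \<le> t" for t
      using has_vector_derivative_diff[OF u[OF that] has_vector_derivative_const[of u_star]]
      by (simp add: h_def lca_field_eq_drive)
  qed
  then have u_lim: "(u \<longlongrightarrow> u_star) at_top"
    by (rule LIM_zero_cancel)
  have "1-lipschitz_on UNIV (activation_vec P lam :: real ^ 'n \<Rightarrow> real ^ 'n)"
    using activation_vec_nonexpansive[OF assms(1)] by (intro lipschitz_onI) auto
  then have "isCont (activation_vec P lam) u_star"
    using lipschitz_on_continuous_on continuous_on_eq_continuous_at open_UNIV by blast
  then have "((\<lambda>t. activation_vec P lam (u t)) \<longlongrightarrow> activation_vec P lam u_star) at_top"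
    using u_lim by (rule isCont_tendsto_compose)
  then have act: "activation_vec P lam u_star = a_star"
    using a_lim tendsto_unique trivial_limit_at_top_linorder by blast
  then have "u_star \<in> lca_fixed_points P \<Phi> s lam"
    by (simp add: lca_fixed_points_def lca_field_eq_drive u_star_def)
  moreover have "((\<lambda>t. lca_flow P \<Phi> s lam t u0) \<longlongrightarrow> u_star) at_top"
  proof (rule Lim_transform_eventually[OF u_lim])
    show "eventually (\<lambda>t. u t = lca_flow P \<Phi> s lam t u0) at_top"
      using eventually_ge_at_top[of 0]
      by eventually_elim (simp add: lca_flow_eq_solution[OF assms(1) sol])
  qed
  ultimately show ?thesis
    using act by blast
qed

end
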